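(* Let $\Omega\subset\mathbb{R}^n$ be a nonempty convex set and let $I\subset\{1,\dots,n\}$ be a nonempty index set such that $\pi_I(\Omega)$ is unbounded. Then: (i) $T(\infty_I;\Omega)$ and $N(\infty_I;\Omega)$ are closed convex cones; (ii) $N(\infty_I;\Omega)=[T(\infty_I;\Omega)]^\circ$ and $T(\infty_I;\Omega)=[N(\infty_I;\Omega)]^\circ$; (iii) if $x_k\in\Omega$, $\|\pi_I(x_k)\|\to\infty$, $v_k\in N(x_k;\Omega)$ and $v_k\to v$, then $v\in N(\infty_I;\Omega)$; (iv) for every open set $V\subset\mathbb{R}^n$ with $T(\infty_I;\Omega)\cap V\ne\emptyset$ there exists $\gamma>0$ such that $T(x;\Omega)\cap V\neq\emptyset$ for all $x\in\Omega\setminus(\gamma B_I)$.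
   Context: $\mathbb{R}^n$ carries the Euclidean inner product and norm. For a nonempty index set $I\subset\{1,\dots,n\}$, $\pi_I(x)=(x_i)_{i\in I}$ and $B_I=\{x\in\mathbb{R}^n\mid\|\pi_I(x)\|\le 1\}$. For a cone $C$, the polar is $C^\circ=\{v\mid\langle v,x\rangle\le 0\ \forall x\in C\}$. For $x\in\Omega$ ($\Omega$ convex), $T(x;\Omega)=\mathrm{cl}\,\{\lambda(y-x)\mid\lambda\ge 0,\ y\in\Omega\}$ and $N(x;\Omega)=\{v\mid\langle v,y-x\rangle\le 0\ \forall y\in\Omega\}$. Tangent cone at infinity: $T(\infty_I;\Omega)$ is the set of $w\in\mathbb{R}^n$ such that for all sequences $x_k\in\Omega$ with $\|\pi_I(x_k)\|\to\infty$ and all $t_k>0$ with $t_k\to 0$ there exist $w_k\to w$ with $x_k+t_kw_k\in\Omega$ for all $k$. Normal cone at infinity: $N(\infty_I;\Omega)=\{v\mid\langle v,w\rangle\le 0\ \forall w\in T(\infty_I;\Omega)\}$. *)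

theory Defs
  imports "HOL-Analysis.Analysis"
begin

text \<open>The Euclidean space indexed by \<open>I\<close> is identified with the coordinate subspace of
  the vectors that vanish outside \<open>I\<close>; by \<open>norm_proj_on\<close> below, the identification preserves
  the Euclidean norm.\<close>

definition proj_on :: "'n::finite set \<Rightarrow> real ^ 'n \<Rightarrow> real ^ 'n" where
  "proj_on I x = (\<chi> i. if i \<in> I then x $ i else 0)"

lemma norm_proj_on: "norm (proj_on I x) = L2_set (\<lambda>i. x $ i) I"
proof -
  have "(\<Sum>i\<in>UNIV. (proj_on I x $ i)\<^sup>2) = (\<Sum>i\<in>I. (x $ i)\<^sup>2)"
    by (rule sum.mono_neutral_cong_right) (auto simp: proj_on_def)
  then show ?thesis
    by (simp add: norm_vec_def L2_set_def)
qed

definition cylinder :: "'n::finite set \<Rightarrow> (real ^ 'n) set" where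
  "cylinder I = {x. norm (proj_on I x) \<le> 1}"

definition polar :: "'a::real_inner set \<Rightarrow> 'a set" where
  "polar C = {v. \<forall>x\<in>C. v \<bullet> x \<le> 0}"

definition tangent_cone :: "'a::real_inner \<Rightarrow> 'a set \<Rightarrow> 'a set" where
  "tangent_cone x \<Omega> = closure {c *\<^sub>R (y - x) | c y. c \<ge> 0 \<and> y \<in> \<Omega>}"

definition normal_cone :: "'a::real_inner \<Rightarrow> 'a set \<Rightarrow> 'a set" where
  "normal_cone x \<Omega> = {v. \<forall>y\<in>\<Omega>. v \<bullet> (y - x) \<le> 0}"

definition tangent_cone_inf :: "'n::finite set \<Rightarrow> (real ^ 'n) set \<Rightarrow> (real ^ 'n) set" where
  "tangent_cone_inf I \<Omega> =
    {w. \<forall>(x :: nat \<Rightarrow> real ^ 'n) (t :: nat \<Rightarrow> real).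
          (\<forall>k. x k \<in> \<Omega>) \<longrightarrow>
          filterlim (\<lambda>k. norm (proj_on I (x k))) at_top sequentially \<longrightarrow>
          (\<forall>k. t k > 0) \<longrightarrow> t \<longlonglongrightarrow> 0 \<longrightarrow>
          (\<exists>u :: nat \<Rightarrow> real ^ 'n. u \<longlonglongrightarrow> w \<and> (\<forall>k. x k + t k *\<^sub>R u k \<in> \<Omega>))}"

definition normal_cone_inf :: "'n::finite set \<Rightarrow> (real ^ 'n) set \<Rightarrow> (real ^ 'n) set" where
  "normal_cone_inf I \<Omega> = {v. \<forall>w\<in>tangent_cone_inf I \<Omega>. v \<bullet> w \<le> 0}"

end

theory Submission
  imports Defs
begin

text \<open>Everything rests on a sequence-free description of the tangent cone at infinity: \<open>w\<close> belongs
  to it iff, uniformly over all \<open>x \<in> \<Omega>\<close> far out in the \<open>I\<close>-directions and all small \<open>t > 0\<close>, some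
  direction close to \<open>w\<close> leads from \<open>x\<close> to a point of \<open>\<Omega>\<close> in time \<open>t\<close>. Closedness and (iv) are
  read off from it; convexity of \<open>\<Omega>\<close> passes directly to the cone; the bipolar theorem then gives (ii), and
  (iii) is the limit of \<open>\<langle>v\<^sub>k, u\<^sub>k\<rangle> \<le> 0\<close> along directions \<open>u\<^sub>k \<rightarrow> w\<close> into \<open>\<Omega>\<close>.\<close>

section \<open>Polar cones and the bipolar theorem\<close>

lemma polar_eq_Inter_halfspaces: "polar C = (\<Inter>x\<in>C. {v. x \<bullet> v \<le> 0})"
  by (auto simp: polar_def inner_commute)

lemma closed_polar: "closed (polar C)"
  by (auto simp: polar_eq_Inter_halfspaces closed_halfspace_le)

lemma convex_polar: "convex (polar C)"
  by (auto simp: polar_eq_Inter_halfspaces intro!: convex_INT convex_halfspace_le)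

lemma cone_polar: "cone (polar C)"
  by (auto simp: cone_def polar_def mult_nonneg_nonpos)

text \<open>The bipolar theorem, by separation. A point \<open>z\<close> outside \<open>C\<close> is
  strictly separated from \<open>C\<close> by some \<open>a\<close>. As \<open>C\<close> is a cone,
  \<open>a\<close> cannot be negative anywhere on it, so \<open>- a\<close> lies in the polar and
  yet has positive inner product with \<open>z\<close>.\<close>

lemma polar_polar:
  fixes C :: "'a::euclidean_space set"
  assumes "closed C" "convex C" "cone C" "C \<noteq> {}"
  shows "polar (polar C) = C"
proof
  show "C \<subseteq> polar (polar C)"
    by (auto simp: polar_def inner_commute)
  show "polar (polar C) \<subseteq> C"
  proof
    fix z assume z: "z \<in> polar (polar C)"
    show "z \<in> C"
    proof (rule ccontr)
      assume "z \<notin> C"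
      then obtain a b where az: "a \<bullet> z < b" and aC: "\<And>x. x \<in> C \<Longrightarrow> b < a \<bullet> x"
        using separating_hyperplane_closed_point[OF assms(2,1)] by blast
      have "0 \<in> C"
        using assms(3,4) cone_contains_0 by blast
      with aC have "b < 0" by fastforce
      have "0 \<le> a \<bullet> x" if "x \<in> C" for x
      proof (rule ccontr)
        assume neg: "\<not> 0 \<le> a \<bullet> x"
        \<comment> \<open>\<open>c\<close> scales \<open>x\<close> onto the hyperplane where
          \<open>a\<close> takes the value \<open>b\<close>, while all of \<open>C\<close> lies
          strictly to one side of it.\<close>
        define c where "c = b / (a \<bullet> x)"
        have "0 \<le> c" "a \<bullet> (c *\<^sub>R x) = b"
          using neg \<open>b < 0\<close> by (auto simp: c_def divide_nonpos_neg)
        moreover from this have "c *\<^sub>R x \<in> C"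
          using assms(3) that by (auto simp: cone_def)
        ultimately show False using aC by fastforce
      qed
      then have "- a \<in> polar C"
        by (auto simp: polar_def)
      with z have "z \<bullet> (- a) \<le> 0"
        unfolding polar_def by blast
      with az \<open>b < 0\<close> show False
        by (simp add: inner_commute)
    qed
  qed
qed

section \<open>The uniform description of the tangent cone at infinity\<close>

lemma tangent_cone_infE:
  assumes "w \<in> tangent_cone_inf I \<Omega>" "\<And>k. x k \<in> \<Omega>"
    "filterlim (\<lambda>k. norm (proj_on I (x k))) at_top sequentially"
    "\<And>k. t k > 0" "t \<longlonglongrightarrow> 0"
  obtains u where "u \<longlonglongrightarrow> w" "\<And>k. x k + t k *\<^sub>R u k \<in> \<Omega>"
  using assms unfolding tangent_cone_inf_def by blast

text \<open>If no pair of thresholds worked, the failures would form sequences admissible in the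
  definition. The directions it supplies converge to \<open>w\<close>, although none of them comes
  within \<open>e\<close> of it.\<close>

lemma tangent_cone_inf_uniform:
  assumes w: "w \<in> tangent_cone_inf I \<Omega>" and "e > 0"
  obtains \<gamma> \<delta> where "\<gamma> > 0" "\<delta> > 0"
    "\<And>x t. x \<in> \<Omega> \<Longrightarrow> norm (proj_on I x) > \<gamma> \<Longrightarrow> 0 < t \<Longrightarrow> t < \<delta> \<Longrightarrow>
      \<exists>u. dist u w < e \<and> x + t *\<^sub>R u \<in> \<Omega>"
proof -
  let ?P = "\<lambda>\<gamma> \<delta>. \<forall>x t. x \<in> \<Omega> \<longrightarrow> norm (proj_on I x) > \<gamma> \<longrightarrow> 0 < t \<longrightarrow> t < \<delta> \<longrightarrow>
      (\<exists>u. dist u w < e \<and> x + t *\<^sub>R u \<in> \<Omega>)"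
  \<comment> \<open>One index drives both thresholds, so that failure at every \<open>k\<close>
    sends \<open>x k\<close> to infinity and \<open>t k\<close> to 0. \<open>Suc\<close> keeps both
    thresholds positive at \<open>k = 0\<close>.\<close>
  have "\<exists>k. ?P (real (Suc k)) (1 / real (Suc k))"
  proof (rule ccontr)
    assume "\<nexists>k. ?P (real (Suc k)) (1 / real (Suc k))"
    then have "\<forall>k. \<exists>x t. x \<in> \<Omega> \<and> norm (proj_on I x) > real (Suc k) \<and> 0 < t \<and>
        t < 1 / real (Suc k) \<and> \<not> (\<exists>u. dist u w < e \<and> x + t *\<^sub>R u \<in> \<Omega>)"
      by blast
    then obtain x t where x: "\<And>k. x k \<in> \<Omega>" "\<And>k. norm (proj_on I (x k)) > real (Suc k)"
      and t: "\<And>k. 0 < t k" "\<And>k. t k < 1 / real (Suc k)"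
      and bad: "\<And>k. \<not> (\<exists>u. dist u w < e \<and> x k + t k *\<^sub>R u \<in> \<Omega>)"
      by metis
    have "real k \<le> norm (proj_on I (x k))" for k
      using x(2)[of k] by simp
    then have "filterlim (\<lambda>k. norm (proj_on I (x k))) at_top sequentially"
      by (intro filterlim_at_top_mono[OF filterlim_real_sequentially]) auto
    moreover have "t \<longlonglongrightarrow> 0"
      by (rule tendsto_sandwich[OF _ _ tendsto_const lim_1_over_n[THEN LIMSEQ_Suc]])
        (use t in \<open>auto intro!: always_eventually less_imp_le simp del: of_nat_Suc\<close>)
    ultimately obtain u where "u \<longlonglongrightarrow> w" and u: "\<And>k. x k + t k *\<^sub>R u k \<in> \<Omega>"
      by (rule tangent_cone_infE[where t = t, OF w x(1) _ t(1)]) blast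
    then obtain k where "dist (u k) w < e"
      using \<open>e > 0\<close> by (metis lim_sequentially order_refl)
    with u bad show False by blast
  qed
  then obtain k where "?P (real (Suc k)) (1 / real (Suc k))" ..
  then show thesis
    by (intro that[of "real (Suc k)" "1 / real (Suc k)"]) auto
qed

text \<open>One sequence of directions has to serve every \<open>e\<close> at once, so each term is
  chosen without reference to \<open>e\<close>: almost closest to \<open>w\<close> among the
  directions admissible at that index. The hypothesis makes the distances from \<open>w\<close> to
  these direction sets tend to 0.\<close>

lemma tangent_cone_inf_uniformI:
  assumes uni: "\<And>e. e > 0 \<Longrightarrow> \<exists>\<gamma>. \<exists>\<delta>>0. \<forall>x t. x \<in> \<Omega> \<longrightarrow> norm (proj_on I x) > \<gamma> \<longrightarrow>
      0 < t \<longrightarrow> t < \<delta> \<longrightarrow> (\<exists>u. dist u w < e \<and> x + t *\<^sub>R u \<in> \<Omega>)"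
  shows "w \<in> tangent_cone_inf I \<Omega>"
proof -
  have "\<exists>u. u \<longlonglongrightarrow> w \<and> (\<forall>k. x k + t k *\<^sub>R u k \<in> \<Omega>)"
    if x: "\<forall>k. x k \<in> \<Omega>" "filterlim (\<lambda>k. norm (proj_on I (x k))) at_top sequentially"
      and t: "\<forall>k. t k > 0" "t \<longlonglongrightarrow> 0" for x t
  proof -
    define D where "D k = {u. x k + t k *\<^sub>R u \<in> \<Omega>}" for k
    \<comment> \<open>The direction 0 is admissible because \<open>x k\<close> itself is in
      \<open>\<Omega>\<close>. This matters, since \<open>infdist\<close> to the empty set is 0 by
      convention.\<close>
    have ne: "D k \<noteq> {}" for k
      using x(1) by (auto simp: D_def intro!: exI[of _ 0])
    \<comment> \<open>The infimum of the distances over \<open>D k\<close> need not be attained, as \<open>\<Omega>\<close> is not assumed closed.\<close>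
    have "\<exists>u\<in>D k. dist w u < infdist w (D k) + 1 / real (Suc k)" for k
    proof -
      have "(INF u\<in>D k. dist w u) < infdist w (D k) + 1 / real (Suc k)"
        using ne by (simp add: infdist_notempty)
      then show ?thesis
        using ne by (subst (asm) cINF_less_iff) auto
    qed
    then obtain u where u: "\<And>k. u k \<in> D k" "\<And>k. dist w (u k) < infdist w (D k) + 1 / real (Suc k)"
      by metis
    have "u \<longlonglongrightarrow> w"
    proof (rule tendstoI)
      fix e :: real assume "e > 0"
      then obtain \<gamma> \<delta> where "\<delta> > 0" and near: "\<And>x t. x \<in> \<Omega> \<Longrightarrow> norm (proj_on I x) > \<gamma> \<Longrightarrow>
          0 < t \<Longrightarrow> t < \<delta> \<Longrightarrow> \<exists>u. dist u w < e / 2 \<and> x + t *\<^sub>R u \<in> \<Omega>"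
        using uni[of "e / 2"] by force
      have "eventually (\<lambda>k. norm (proj_on I (x k)) > \<gamma>) sequentially"
        using x(2) by (simp add: filterlim_at_top_dense)
      moreover have "eventually (\<lambda>k. t k < \<delta>) sequentially"
        using t(2) \<open>\<delta> > 0\<close> by (rule order_tendstoD)
      moreover have "eventually (\<lambda>k. 1 / real (Suc k) < e / 2) sequentially"
        using lim_1_over_n[THEN LIMSEQ_Suc] \<open>e > 0\<close> by (intro order_tendstoD) auto
      ultimately show "eventually (\<lambda>k. dist (u k) w < e) sequentially"
      proof eventually_elim
        case (elim k)
        then obtain v where v: "dist v w < e / 2" "v \<in> D k"
          using near[of "x k" "t k"] x(1) t(1) by (auto simp: D_def)
        \<comment> \<open>\<open>v\<close> keeps the infimum below \<open>e / 2\<close>, and the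
          slack in the choice of \<open>u k\<close> costs less than another
          \<open>e / 2\<close>.\<close>
        have "infdist w (D k) \<le> dist w v"
          using v by (intro infdist_le)
        with u(2)[of k] v elim(3) show ?case
          by (simp add: dist_commute)
      qed
    qed
    with u(1) show ?thesis
      by (auto simp: D_def)
  qed
  then show ?thesis
    unfolding tangent_cone_inf_def by blast
qed

section \<open>Closedness, convexity and the cone property\<close>

lemma closed_tangent_cone_inf: "closed (tangent_cone_inf I \<Omega>)"
proof -
  have "w \<in> tangent_cone_inf I \<Omega>" if w: "w \<in> closure (tangent_cone_inf I \<Omega>)" for w
  proof (rule tangent_cone_inf_uniformI)
    fix e :: real assume "e > 0"
    then obtain w' where w': "w' \<in> tangent_cone_inf I \<Omega>" "dist w' w < e / 2"
      using w by (meson closure_approachable half_gt_zero)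
    \<comment> \<open>The thresholds of the nearby \<open>w'\<close> at accuracy
      \<open>e / 2\<close> serve \<open>w\<close> at accuracy \<open>e\<close>.\<close>
    obtain \<gamma> \<delta> where "\<delta> > 0" and near: "\<And>x t. x \<in> \<Omega> \<Longrightarrow> norm (proj_on I x) > \<gamma> \<Longrightarrow> 0 < t \<Longrightarrow>
        t < \<delta> \<Longrightarrow> \<exists>u. dist u w' < e / 2 \<and> x + t *\<^sub>R u \<in> \<Omega>"
      by (rule tangent_cone_inf_uniform[OF w'(1), of "e / 2"]) (use \<open>e > 0\<close> in auto)
    have "dist u w < e" if "dist u w' < e / 2" for u
      using that w'(2) dist_triangle_half_l[of u w' e w] by (simp add: dist_commute)
    with \<open>\<delta> > 0\<close> near show "\<exists>\<gamma>. \<exists>\<delta>>0. \<forall>x t. x \<in> \<Omega> \<longrightarrow> norm (proj_on I x) > \<gamma> \<longrightarrow>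
      0 < t \<longrightarrow> t < \<delta> \<longrightarrow> (\<exists>u. dist u w < e \<and> x + t *\<^sub>R u \<in> \<Omega>)"
      by meson
  qed
  then show ?thesis
    by (meson closure_subset_eq subsetI)
qed

lemma zero_in_tangent_cone_inf: "0 \<in> tangent_cone_inf I \<Omega>"
  by (auto simp: tangent_cone_inf_def intro!: exI[of _ "\<lambda>_. 0"])

text \<open>Both directions are tested along the same \<open>x\<close> and \<open>t\<close>. The
  convex combination of the two points reached stays in \<open>\<Omega>\<close> and, as the weights
  sum to 1, is again a step of size \<open>t k\<close> from \<open>x k\<close>.\<close>

lemma convex_tangent_cone_inf:
  assumes "convex \<Omega>"
  shows "convex (tangent_cone_inf I \<Omega>)"
proof (rule convexI)
  fix w1 w2 and a b :: real
  assume w: "w1 \<in> tangent_cone_inf I \<Omega>" "w2 \<in> tangent_cone_inf I \<Omega>"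
    and ab: "0 \<le> a" "0 \<le> b" "a + b = 1"
  have "\<exists>u. u \<longlonglongrightarrow> a *\<^sub>R w1 + b *\<^sub>R w2 \<and> (\<forall>k. x k + t k *\<^sub>R u k \<in> \<Omega>)"
    if xt: "\<forall>k. x k \<in> \<Omega>" "filterlim (\<lambda>k. norm (proj_on I (x k))) at_top sequentially"
      "\<forall>k. t k > 0" "t \<longlonglongrightarrow> 0" for x t
  proof -
    obtain u1 where u1: "u1 \<longlonglongrightarrow> w1" "\<And>k. x k + t k *\<^sub>R u1 k \<in> \<Omega>"
      by (rule tangent_cone_infE[OF w(1) xt[rule_format]]) blast
    obtain u2 where u2: "u2 \<longlonglongrightarrow> w2" "\<And>k. x k + t k *\<^sub>R u2 k \<in> \<Omega>"
      by (rule tangent_cone_infE[OF w(2) xt[rule_format]]) blast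
    have "x k + t k *\<^sub>R (a *\<^sub>R u1 k + b *\<^sub>R u2 k) \<in> \<Omega>" for k
    proof -
      have "a *\<^sub>R (x k + t k *\<^sub>R u1 k) + b *\<^sub>R (x k + t k *\<^sub>R u2 k) \<in> \<Omega>"
        using assms u1(2) u2(2) ab by (intro convexD)
      moreover have "a *\<^sub>R (x k + t k *\<^sub>R u1 k) + b *\<^sub>R (x k + t k *\<^sub>R u2 k) =
          (a + b) *\<^sub>R x k + t k *\<^sub>R (a *\<^sub>R u1 k + b *\<^sub>R u2 k)"
        by (simp add: algebra_simps)
      ultimately show ?thesis using ab(3) by simp
    qed
    moreover have "(\<lambda>k. a *\<^sub>R u1 k + b *\<^sub>R u2 k) \<longlonglongrightarrow> a *\<^sub>R w1 + b *\<^sub>R w2"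
      by (intro tendsto_intros u1 u2)
    ultimately show ?thesis by blast
  qed
  then show "a *\<^sub>R w1 + b *\<^sub>R w2 \<in> tangent_cone_inf I \<Omega>"
    unfolding tangent_cone_inf_def by blast
qed

text \<open>A step of size \<open>c * t k\<close> along \<open>u k\<close> is a step of size
  \<open>t k\<close> along \<open>c\<close> times \<open>u k\<close>. Step sizes must be positive,
  so \<open>c = 0\<close> is treated apart.\<close>

lemma cone_tangent_cone_inf: "cone (tangent_cone_inf I \<Omega>)"
  unfolding cone_def
proof (intro ballI allI impI)
  fix w and c :: real
  assume w: "w \<in> tangent_cone_inf I \<Omega>" and "0 \<le> c"
  show "c *\<^sub>R w \<in> tangent_cone_inf I \<Omega>"
  proof (cases "c = 0")
    case True
    then show ?thesis by (simp add: zero_in_tangent_cone_inf)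
  next
    case False
    have "\<exists>u. u \<longlonglongrightarrow> c *\<^sub>R w \<and> (\<forall>k. x k + t k *\<^sub>R u k \<in> \<Omega>)"
      if xt: "\<forall>k. x k \<in> \<Omega>" "filterlim (\<lambda>k. norm (proj_on I (x k))) at_top sequentially"
        "\<forall>k. t k > 0" "t \<longlonglongrightarrow> 0" for x t
    proof -
      have "\<And>k. c * t k > 0" "(\<lambda>k. c * t k) \<longlonglongrightarrow> 0"
        using xt False \<open>0 \<le> c\<close> by (auto intro: tendsto_mult_right_zero)
      then obtain u where u: "u \<longlonglongrightarrow> w" "\<And>k. x k + (c * t k) *\<^sub>R u k \<in> \<Omega>"
        by (rule tangent_cone_infE[OF w xt(1,2)[rule_format]]) blast
      have "x k + t k *\<^sub>R (c *\<^sub>R u k) \<in> \<Omega>" for k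
        using u(2)[of k] by (simp add: mult.commute)
      moreover have "(\<lambda>k. c *\<^sub>R u k) \<longlonglongrightarrow> c *\<^sub>R w"
        by (intro tendsto_intros u)
      ultimately show ?thesis by blast
    qed
    then show ?thesis
      unfolding tangent_cone_inf_def by blast
  qed
qed

section \<open>The normal cone at infinity and limits of normals\<close>

lemma normal_cone_inf_eq_polar: "normal_cone_inf I \<Omega> = polar (tangent_cone_inf I \<Omega>)"
  by (simp add: normal_cone_inf_def polar_def)

lemma normal_cone_inf_limit:
  assumes x: "\<And>k. x k \<in> \<Omega>" "filterlim (\<lambda>k. norm (proj_on I (x k))) at_top sequentially"
    and v: "\<And>k. v k \<in> normal_cone (x k) \<Omega>" "v \<longlonglongrightarrow> v'"
  shows "v' \<in> normal_cone_inf I \<Omega>"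
  unfolding normal_cone_inf_def
proof (intro CollectI ballI)
  fix w assume w: "w \<in> tangent_cone_inf I \<Omega>"
  \<comment> \<open>Any positive null sequence of step sizes would do: each normal inequality is
    divided by its own step size.\<close>
  have "(\<lambda>k. 1 / real (Suc k)) \<longlonglongrightarrow> 0"
    by (rule lim_1_over_n[THEN LIMSEQ_Suc])
  then obtain u where u: "u \<longlonglongrightarrow> w" "\<And>k. x k + (1 / real (Suc k)) *\<^sub>R u k \<in> \<Omega>"
    using tangent_cone_infE[OF w x, of "\<lambda>k. 1 / real (Suc k)"] by auto
  have "v k \<bullet> u k \<le> 0" for k
  proof -
    have "v k \<bullet> (x k + (1 / real (Suc k)) *\<^sub>R u k - x k) \<le> 0"
      using v(1)[of k] u(2)[of k] unfolding normal_cone_def by blast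
    then show ?thesis
      by (simp add: divide_le_0_iff)
  qed
  moreover have "(\<lambda>k. v k \<bullet> u k) \<longlonglongrightarrow> v' \<bullet> w"
    by (intro tendsto_intros v u)
  ultimately show "v' \<bullet> w \<le> 0"
    by (intro LIMSEQ_le_const2) auto
qed

section \<open>Tangent cones at points far out\<close>

lemma proj_on_scaleR: "proj_on I (c *\<^sub>R x) = c *\<^sub>R proj_on I x"
  by (simp add: proj_on_def vec_eq_iff)

text \<open>Used in contrapositive form: outside the scaled cylinder the projection has norm above
  \<open>\<gamma>\<close>, as the uniform description asks.\<close>

lemma mem_scaled_cylinder:
  assumes "\<gamma> > 0" "norm (proj_on I x) \<le> \<gamma>"
  shows "x \<in> (\<lambda>y. \<gamma> *\<^sub>R y) ` cylinder I"
proof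
  show "x = \<gamma> *\<^sub>R ((1 / \<gamma>) *\<^sub>R x)"
    using assms by simp
  show "(1 / \<gamma>) *\<^sub>R x \<in> cylinder I"
    using assms by (simp add: cylinder_def proj_on_scaleR divide_simps)
qed

text \<open>Dividing the displacement by the time \<open>t\<close> exhibits \<open>u\<close> as an
  element of the set whose closure is taken.\<close>

lemma in_tangent_cone:
  assumes "t > 0" "x + t *\<^sub>R u \<in> \<Omega>"
  shows "u \<in> tangent_cone x \<Omega>"
proof -
  have "(1 / t) *\<^sub>R (x + t *\<^sub>R u - x) \<in> tangent_cone x \<Omega>"
    unfolding tangent_cone_def using assms
    by (intro closure_subset[THEN subsetD] CollectI exI[of _ "1 / t"]
        exI[of _ "x + t *\<^sub>R u"]) auto
  then show ?thesis
    using assms(1) by simp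
qed

lemma tangent_cone_meets_open:
  assumes "open V" "tangent_cone_inf I \<Omega> \<inter> V \<noteq> {}"
  shows "\<exists>\<gamma>>0. \<forall>x \<in> \<Omega> - (\<lambda>y. \<gamma> *\<^sub>R y) ` cylinder I. tangent_cone x \<Omega> \<inter> V \<noteq> {}"
proof -
  obtain w where w: "w \<in> tangent_cone_inf I \<Omega>" "w \<in> V"
    using assms by blast
  then obtain e where e: "e > 0" "\<And>u. dist u w < e \<Longrightarrow> u \<in> V"
    using assms(1) by (metis open_dist)
  obtain \<gamma> \<delta> where pos: "\<gamma> > 0" "\<delta> > 0" and near: "\<And>x t. x \<in> \<Omega> \<Longrightarrow>
      norm (proj_on I x) > \<gamma> \<Longrightarrow> 0 < t \<Longrightarrow> t < \<delta> \<Longrightarrow> \<exists>u. dist u w < e \<and> x + t *\<^sub>R u \<in> \<Omega>"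
    by (rule tangent_cone_inf_uniform[OF w(1) e(1)]) blast
  have "tangent_cone x \<Omega> \<inter> V \<noteq> {}" if x: "x \<in> \<Omega>" "x \<notin> (\<lambda>y. \<gamma> *\<^sub>R y) ` cylinder I" for x
  proof -
    have "norm (proj_on I x) > \<gamma>"
      using mem_scaled_cylinder[OF pos(1)] x(2) not_le by blast
    \<comment> \<open>At a fixed \<open>x\<close> a single positive time suffices;
      \<open>\<delta> / 2\<close> is one below the threshold.\<close>
    then obtain u where "dist u w < e" "x + (\<delta> / 2) *\<^sub>R u \<in> \<Omega>"
      using near[of x "\<delta> / 2"] x(1) pos(2) by auto
    then show ?thesis
      using in_tangent_cone[of "\<delta> / 2" x u \<Omega>] e(2) pos(2) by auto
  qed
  with pos(1) show ?thesis by blast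
qed

theorem proposition3p6:
  fixes \<Omega> :: "(real ^ 'n::finite) set" and I :: "'n set"
  assumes "\<Omega> \<noteq> {}" and "convex \<Omega>" and "I \<noteq> {}"
    and "\<not> bounded (proj_on I ` \<Omega>)"
  shows
    "(closed (tangent_cone_inf I \<Omega>) \<and> convex (tangent_cone_inf I \<Omega>) \<and> cone (tangent_cone_inf I \<Omega>) \<and>
      closed (normal_cone_inf I \<Omega>) \<and> convex (normal_cone_inf I \<Omega>) \<and> cone (normal_cone_inf I \<Omega>)) \<and>
     (normal_cone_inf I \<Omega> = polar (tangent_cone_inf I \<Omega>) \<and>
      tangent_cone_inf I \<Omega> = polar (normal_cone_inf I \<Omega>)) \<and>
     (\<forall>(x :: nat \<Rightarrow> real ^ 'n) (v :: nat \<Rightarrow> real ^ 'n) (v' :: real ^ 'n).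
        (\<forall>k. x k \<in> \<Omega>) \<longrightarrow>
        filterlim (\<lambda>k. norm (proj_on I (x k))) at_top sequentially \<longrightarrow>
        (\<forall>k. v k \<in> normal_cone (x k) \<Omega>) \<longrightarrow> v \<longlonglongrightarrow> v' \<longrightarrow>
        v' \<in> normal_cone_inf I \<Omega>) \<and>
     (\<forall>V :: (real ^ 'n) set. open V \<longrightarrow> tangent_cone_inf I \<Omega> \<inter> V \<noteq> {} \<longrightarrow>
        (\<exists>\<gamma>>0. \<forall>x \<in> \<Omega> - (\<lambda>y. \<gamma> *\<^sub>R y) ` cylinder I. tangent_cone x \<Omega> \<inter> V \<noteq> {}))"
proof (intro conjI allI impI)
  let ?T = "tangent_cone_inf I \<Omega>"
  show T: "closed ?T" "convex ?T" "cone ?T"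
    by (rule closed_tangent_cone_inf convex_tangent_cone_inf[OF assms(2)] cone_tangent_cone_inf)+
  show "closed (normal_cone_inf I \<Omega>)" "convex (normal_cone_inf I \<Omega>)" "cone (normal_cone_inf I \<Omega>)"
    unfolding normal_cone_inf_eq_polar by (rule closed_polar convex_polar cone_polar)+
  show "normal_cone_inf I \<Omega> = polar ?T"
    by (rule normal_cone_inf_eq_polar)
  \<comment> \<open>The bipolar theorem applies to \<open>?T\<close>, which is nonempty because it
    contains 0.\<close>
  show "?T = polar (normal_cone_inf I \<Omega>)"
    unfolding normal_cone_inf_eq_polar
    using polar_polar[OF T] zero_in_tangent_cone_inf by blast
  show "v' \<in> normal_cone_inf I \<Omega>"
    if "\<forall>k. x k \<in> \<Omega>" "filterlim (\<lambda>k. norm (proj_on I (x k))) at_top sequentially"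
      "\<forall>k. v k \<in> normal_cone (x k) \<Omega>" "v \<longlonglongrightarrow> v'" for x v v'
    by (rule normal_cone_inf_limit[OF _ that(2) _ that(4)]) (use that in auto)
qed (rule tangent_cone_meets_open)

end
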